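(* Let $T$ be a random vector with values in $\mathcal{T}\subseteq\mathbb{R}^d$, let $0<\alpha\le\beta$, and let $U:\mathcal{T}\times\mathbb{R}^r\to\mathbb{R}$ be a utility, twice differentiable in its second argument, with oracle action $\phi^*:\mathcal{T}\to\mathbb{R}^r$, such that for every $t\in\mathcal{T}$: (A0) $\phi^*(t)$ is an unconstrained maximizer of $a\mapsto U(t,a)$ on $\mathbb{R}^r$ (hence $\nabla_a U(t,\phi^*(t))=0$); (A1) $\nabla^2_{aa}U(t,a)\succeq-\beta I$ for all $a\in\mathbb{R}^r$; (A2) $\nabla^2_{aa}U(t,a)\preceq-\alpha I$ for all $a\in\mathbb{R}^r$. Let $\ell(t,a)=U(t,\phi^*(t))-U(t,a)$ be the task loss and let $K\ge1$. Let $Q_{\mathrm{LM}}$ be a globally MSE-optimal $K$-level quantizer of $\phi^*(T)$, and let $D_K^*$ be the minimum task distortion over all $K$-level encoders and decoders. Then $$D(Q_{\mathrm{LM}})\;\le\;\frac{\beta}{\alpha}\,D_K^*.$$ Moreover, if the loss is isotropic quadratic, i.e. $U(t,a)=u(t)-\frac{\gamma}{2}\|a-\phi^*(t)\|^2$ for some function $u:\mathcal{T}\to\mathbb{R}$ and some $\gamma>0$, then $Q_{\mathrm{LM}}$ is task-optimal, i.e. $D(Q_{\mathrm{LM}})=D_K^*$.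
   Context: $\|\cdot\|$ is the Euclidean norm, $I$ the $r\times r$ identity, $\succeq,\preceq$ the Loewner order, and $\nabla_a,\nabla^2_{aa}$ the gradient and Hessian in the action variable $a$. $U$ and $\phi^*$ are assumed measurable; $\ell\ge0$, so expectations take values in $[0,\infty]$. A $K$-level quantizer $Q$ consists of a measurable encoder $c:\mathcal{T}\to\{1,\dots,K\}$ and a decoder $\hat\phi_Q:\{1,\dots,K\}\to\mathbb{R}^r$. Its task distortion is $D(Q)=\mathbb{E}[\ell(T,\hat\phi_Q(c(T)))]$ and its MSE is $M(Q)=\mathbb{E}\|\phi^*(T)-\hat\phi_Q(c(T))\|^2$. $D_K^*$ is the infimum of $D(Q)$ over all $K$-level quantizers. A $K$-level quantizer of $\phi^*(T)$ is one whose encoder has the form $c(t)=q(\phi^*(t))$ with $q:\mathbb{R}^r\to\{1,\dots,K\}$ measurable; it is globally MSE-optimal if it minimizes $M$ over all such quantizers. *)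

theory Defs
  imports "HOL-Probability.Probability"
begin

text \<open>
  Derivatives are Frechet derivatives. Both functions below are only meaningful under
  \<open>twice_differentiable\<close>, which makes the gradient unique and the Hessian the Jacobian
  matrix of the gradient.
\<close>

definition gradient :: "(real^'n \<Rightarrow> real) \<Rightarrow> real^'n \<Rightarrow> real^'n" where
  "gradient f a = (THE g. GDERIV f a :> g)"

definition hessian :: "(real^'n \<Rightarrow> real) \<Rightarrow> real^'n \<Rightarrow> real^'n^'n" where
  "hessian f a = jacobian (gradient f) (at a)"

definition twice_differentiable :: "(real^'n \<Rightarrow> real) \<Rightarrow> bool" where
  "twice_differentiable f \<longleftrightarrow>
     (\<forall>a. f differentiable (at a)) \<and> (\<forall>a. gradient f differentiable (at a))"

text \<open>
  Symmetry is not part of the order: it is applied only to Hessians of twice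
  differentiable functions and to multiples of the identity, which are symmetric.
\<close>

definition loewner_le :: "real^'n^'n \<Rightarrow> real^'n^'n \<Rightarrow> bool" where
  "loewner_le A B \<longleftrightarrow> (\<forall>x. 0 \<le> x \<bullet> ((B - A) *v x))"

definition task_loss :: "('t \<Rightarrow> 'a \<Rightarrow> real) \<Rightarrow> ('t \<Rightarrow> 'a) \<Rightarrow> 't \<Rightarrow> 'a \<Rightarrow> real" where
  "task_loss U \<phi> t a = U t (\<phi> t) - U t a"

datatype ('t, 'a) quantizer = Quantizer (encoder: "'t \<Rightarrow> nat") (decoder: "nat \<Rightarrow> 'a")

text \<open>
  The measure \<open>N\<close> carries the space of task variables and its sigma-algebra. Decoder values
  outside \<open>{1..K}\<close> are never used.
\<close>

definition is_quantizer :: "'t measure \<Rightarrow> nat \<Rightarrow> ('t, 'a) quantizer \<Rightarrow> bool" where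
  "is_quantizer N K Q \<longleftrightarrow> encoder Q \<in> N \<rightarrow>\<^sub>M count_space {1..K}"

definition is_quantizer_of ::
  "'t measure \<Rightarrow> ('t \<Rightarrow> 'a::topological_space) \<Rightarrow> nat \<Rightarrow> ('t, 'a) quantizer \<Rightarrow> bool" where
  "is_quantizer_of N \<phi> K Q \<longleftrightarrow>
     is_quantizer N K Q \<and>
     (\<exists>q \<in> borel \<rightarrow>\<^sub>M count_space {1..K}. \<forall>t \<in> space N. encoder Q t = q (\<phi> t))"

text \<open>
  Expectations take values in the extended nonnegative reals. The coercion \<open>ennreal\<close> truncates
  negative reals to 0, which has no effect on a nonnegative loss.
\<close>

definition task_distortion ::
  "'w measure \<Rightarrow> ('w \<Rightarrow> 't) \<Rightarrow> ('t \<Rightarrow> 'a \<Rightarrow> real) \<Rightarrow> ('t, 'a) quantizer \<Rightarrow> ennreal" where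
  "task_distortion P T l Q = (\<integral>\<^sup>+ \<omega>. ennreal (l (T \<omega>) (decoder Q (encoder Q (T \<omega>)))) \<partial>P)"

definition mse ::
  "'w measure \<Rightarrow> ('w \<Rightarrow> 't) \<Rightarrow> ('t \<Rightarrow> 'a::real_normed_vector) \<Rightarrow> ('t, 'a) quantizer \<Rightarrow> ennreal" where
  "mse P T \<phi> Q = (\<integral>\<^sup>+ \<omega>. ennreal ((norm (\<phi> (T \<omega>) - decoder Q (encoder Q (T \<omega>))))\<^sup>2) \<partial>P)"

definition optimal_task_distortion ::
  "'w measure \<Rightarrow> 't measure \<Rightarrow> ('w \<Rightarrow> 't) \<Rightarrow> ('t \<Rightarrow> 'a \<Rightarrow> real) \<Rightarrow> nat \<Rightarrow> ennreal" where
  "optimal_task_distortion P N T l K = (INF Q \<in> {Q. is_quantizer N K Q}. task_distortion P T l Q)"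

definition mse_optimal ::
  "'w measure \<Rightarrow> 't measure \<Rightarrow> ('w \<Rightarrow> 't) \<Rightarrow> ('t \<Rightarrow> 'a::real_normed_vector) \<Rightarrow> nat \<Rightarrow>
   ('t, 'a) quantizer \<Rightarrow> bool" where
  "mse_optimal P N T \<phi> K Q \<longleftrightarrow>
     is_quantizer_of N \<phi> K Q \<and>
     (\<forall>Q'. is_quantizer_of N \<phi> K Q' \<longrightarrow> mse P T \<phi> Q \<le> mse P T \<phi> Q')"

end

theory Submission
  imports Defs
begin

text \<open>
  Second-order Taylor expansion around the maximizer squeezes the task loss between
  \<open>\<alpha>/2\<close> and \<open>\<beta>/2\<close> times the squared distance to the oracle action, so task distortion and
  MSE agree up to these factors. The encoder of an arbitrary quantizer may look at more than
  the oracle action, but re-encoding each oracle action to its nearest codeword does not increase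
  the MSE and yields a competitor for the MSE-optimal quantizer.
\<close>

text \<open>\<open>gradient\<close> is a definite description, so it is usable only once existence
  and uniqueness are known. The Riesz representative \<open>adjoint D 1\<close> of the derivative
  gives existence; uniqueness of the Frechet derivative fixes its values on all directions, and
  hence the vector.\<close>

lemma gradient_has_derivative:
  fixes f :: "real^'n \<Rightarrow> real"
  assumes "f differentiable (at a)"
  shows "(f has_derivative (\<lambda>h. h \<bullet> gradient f a)) (at a)"
proof -
  obtain D where D: "(f has_derivative D) (at a)"
    using assms by (auto simp: differentiable_def)
  define g where "g = adjoint D 1"
  have "D = (\<lambda>h. h \<bullet> g)"
    using adjoint_works[OF has_derivative_linear[OF D], of _ 1] by (simp add: fun_eq_iff g_def)
  with D have "GDERIV f a :> g"
    by (simp add: gderiv_def)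
  moreover have "g' = g" if "GDERIV f a :> g'" for g'
  proof -
    have "(\<lambda>h. h \<bullet> g') = (\<lambda>h. h \<bullet> g)"
      using that \<open>GDERIV f a :> g\<close> unfolding gderiv_def by (rule has_derivative_unique)
    then show ?thesis
      by (simp add: fun_eq_iff vector_eq_ldot)
  qed
  ultimately have "GDERIV f a :> gradient f a"
    unfolding gradient_def by (rule theI)
  then show ?thesis by (simp add: gderiv_def)
qed

lemma hessian_has_derivative:
  assumes "gradient f differentiable (at a)"
  shows "(gradient f has_derivative (\<lambda>h. hessian f a *v h)) (at a)"
  using assms unfolding hessian_def by (simp add: jacobian_works)

lemma gradient_eq_0_if_maximum:
  fixes f :: "real^'n \<Rightarrow> real"
  assumes "f differentiable (at p)" and "\<And>a. f a \<le> f p"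
  shows "gradient f p = 0"
proof -
  have "(\<lambda>h. h \<bullet> gradient f p) = (\<lambda>h. 0)"
    using gradient_has_derivative[OF assms(1)] assms(2)
    by (intro differential_zero_maxmin[of p UNIV f]) auto
  from fun_cong[OF this, of "gradient f p"] show ?thesis
    by simp
qed

text \<open>Taylor's theorem with Lagrange remainder on the segment from \<open>p\<close> to
  \<open>a\<close>, where \<open>b\<close> is the intermediate point. The first-order term vanishes
  because \<open>p\<close> is a maximizer. The Lagrange form fits a Hessian that is merely known to
  exist everywhere.\<close>

lemma taylor_at_maximum:
  fixes f :: "real^'n \<Rightarrow> real"
  assumes diff: "twice_differentiable f" and max: "\<And>a. f a \<le> f p"
  obtains b where "f a = f p + ((a - p) \<bullet> (hessian f b *v (a - p))) / 2"
proof -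
  define d where "d = a - p"
  \<comment> \<open>The restriction of \<open>f\<close> to the line through \<open>p\<close> in
    direction \<open>d\<close>, with its first and second derivatives, packed into one family
    indexed by the order as \<open>Maclaurin\<close> expects. At \<open>s = 1\<close> the line
    reaches \<open>a\<close>.\<close>
  define g where "g m s = (if m = 0 then f (p + s *\<^sub>R d)
    else if m = 1 then d \<bullet> gradient f (p + s *\<^sub>R d)
    else d \<bullet> (hessian f (p + s *\<^sub>R d) *v d))" for m :: nat and s :: real
  have df: "f differentiable (at x)" and dg: "gradient f differentiable (at x)" for x
    using diff by (auto simp: twice_differentiable_def)
  have line: "((\<lambda>s. p + s *\<^sub>R d) has_derivative (\<lambda>h. h *\<^sub>R d)) (at s)" for s
    by (auto intro!: derivative_eq_intros)
  have "(g 0 has_real_derivative g 1 s) (at s)" for s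
    using has_derivative_compose[OF line gradient_has_derivative[OF df]]
    unfolding g_def has_field_derivative_def by (simp add: mult_commute_abs)
  moreover have "(g 1 has_real_derivative g 2 s) (at s)" for s
    using has_derivative_inner_right[OF
        has_derivative_compose[OF line hessian_has_derivative[OF dg]], of d]
    unfolding g_def has_field_derivative_def
    by (simp add: matrix_vector_mult_scaleR mult_commute_abs)
  ultimately have "\<forall>m s. m < 2 \<and> 0 \<le> s \<and> s \<le> 1 \<longrightarrow> DERIV (g m) s :> g (Suc m) s"
    by (auto simp: less_2_cases_iff simp flip: numeral_2_eq_2)
  from Maclaurin[of 1 2 g "g 0", OF _ _ _ this] obtain s where
    "g 0 1 = (\<Sum>m<2. g m 0 / fact m * 1 ^ m) + g 2 s / fact 2 * 1 ^ 2"
    by auto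
  moreover have "g 1 0 = 0"
    using gradient_eq_0_if_maximum[OF df max] by (simp add: g_def)
  ultimately have "f a = f p + (d \<bullet> (hessian f (p + s *\<^sub>R d) *v d)) / 2"
    by (simp add: g_def numeral_2_eq_2 d_def)
  then show thesis
    using that unfolding d_def by blast
qed

lemma loewner_le_quadratic_form:
  assumes "loewner_le A B"
  shows "x \<bullet> (A *v x) \<le> x \<bullet> (B *v x)"
  using assms by (simp add: loewner_le_def matrix_vector_mult_diff_rdistrib inner_diff_right)

lemma quadratic_form_scaled_mat:
  fixes x :: "real^'n"
  shows "x \<bullet> ((c *\<^sub>R mat 1) *v x) = c * (norm x)\<^sup>2"
  by (simp add: scaleR_matrix_vector_assoc[symmetric] power2_norm_eq_inner)

text \<open>The order reverses: a lower bound on the Hessian limits how fast \<open>f\<close> can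
  fall away from its maximum, so it bounds the loss from above. Dually, an upper bound on the
  Hessian forces a minimal loss.\<close>

lemma upper_quadratic_bound:
  fixes f :: "real^'n \<Rightarrow> real"
  assumes "twice_differentiable f" and "\<And>a. f a \<le> f p"
    and A1: "\<And>b. loewner_le ((- \<beta>) *\<^sub>R mat 1) (hessian f b)"
  shows "f p - f a \<le> \<beta> / 2 * (norm (p - a))\<^sup>2"
proof -
  obtain b where "f a = f p + ((a - p) \<bullet> (hessian f b *v (a - p))) / 2"
    using taylor_at_maximum[OF assms(1,2)] by blast
  then show ?thesis
    using loewner_le_quadratic_form[OF A1, of "a - p" b]
    unfolding quadratic_form_scaled_mat by (simp add: norm_minus_commute)
qed

lemma lower_quadratic_bound:
  fixes f :: "real^'n \<Rightarrow> real"
  assumes "twice_differentiable f" and "\<And>a. f a \<le> f p"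
    and A2: "\<And>b. loewner_le (hessian f b) ((- \<alpha>) *\<^sub>R mat 1)"
  shows "\<alpha> / 2 * (norm (p - a))\<^sup>2 \<le> f p - f a"
proof -
  obtain b where "f a = f p + ((a - p) \<bullet> (hessian f b *v (a - p))) / 2"
    using taylor_at_maximum[OF assms(1,2)] by blast
  then show ?thesis
    using loewner_le_quadratic_form[OF A2, of "a - p" b]
    unfolding quadratic_form_scaled_mat by (simp add: norm_minus_commute)
qed

text \<open>A minimizer over finitely many codewords exists for each point; the issue is to choose
  it measurably. Breaking ties by the least index does this.\<close>

lemma nearest_codeword:
  fixes d :: "nat \<Rightarrow> 'a::euclidean_space"
  assumes "1 \<le> K"
  obtains q where "q \<in> borel \<rightarrow>\<^sub>M count_space {1..K}"
    and "\<And>x k. k \<in> {1..K} \<Longrightarrow> norm (x - d (q x)) \<le> norm (x - d k)"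
proof -
  define nearest where
    "nearest k x \<longleftrightarrow> k \<in> {1..K} \<and> (\<forall>j\<in>{1..K}. norm (x - d k) \<le> norm (x - d j))" for k x
  define q where "q x = (LEAST k. nearest k x)" for x
  have q: "nearest (q x) x" for x
  proof -
    have "finite {1..K}" "{1..K} \<noteq> {}" using assms by auto
    from ex_is_arg_min_if_finite[OF this, of "\<lambda>k. norm (x - d k)"]
    have "\<exists>k. nearest k x"
      by (auto simp: nearest_def is_arg_min_linorder)
    then show ?thesis
      unfolding q_def by (rule LeastI_ex)
  qed
  have "Measurable.pred borel (nearest k)" for k
    unfolding nearest_def by measurable
  then have "q \<in> borel \<rightarrow>\<^sub>M count_space UNIV"
    unfolding q_def by measurable
  \<comment> \<open>The codomain is narrowed from \<open>UNIV\<close> to \<open>{1..K}\<close>: for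
    a countable target, range and preimages of singletons decide measurability.\<close>
  then have "q -` {k} \<in> sets borel" for k
    using measurable_sets[of q borel "count_space UNIV" "{k}"] by simp
  then have "q \<in> borel \<rightarrow>\<^sub>M count_space {1..K}"
    using q by (auto simp: measurable_count_space_eq2 nearest_def)
  with q show thesis
    using that unfolding nearest_def by blast
qed

lemma encoder_in_range:
  assumes "is_quantizer N K Q" and "t \<in> space N"
  shows "encoder Q t \<in> {1..K}"
  using measurable_space[OF assms(1)[unfolded is_quantizer_def] assms(2)] by simp

text \<open>Optimality is assumed only against encoders that factor through \<open>\<phi>\<close>.
  Keeping the decoder of \<open>Q\<close> and sending each oracle action to its nearest codeword
  gives such a competitor, whose error is no larger at any sample point.\<close>

lemma mse_optimal_le:
  fixes \<phi> :: "'t \<Rightarrow> 'a::euclidean_space"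
  assumes opt: "mse_optimal P N T \<phi> K Q\<^sub>0" and Q: "is_quantizer N K Q"
    and T: "T \<in> P \<rightarrow>\<^sub>M N" and \<phi>: "\<phi> \<in> borel_measurable N" and K: "1 \<le> K"
  shows "mse P T \<phi> Q\<^sub>0 \<le> mse P T \<phi> Q"
proof -
  obtain q where q: "q \<in> borel \<rightarrow>\<^sub>M count_space {1..K}"
    and near: "\<And>x k. k \<in> {1..K} \<Longrightarrow> norm (x - decoder Q (q x)) \<le> norm (x - decoder Q k)"
    using nearest_codeword[OF K] by blast
  define Q' where "Q' = Quantizer (\<lambda>t. q (\<phi> t)) (decoder Q)"
  have "is_quantizer_of N \<phi> K Q'"
    using q measurable_compose[OF \<phi> q]
    by (auto simp: is_quantizer_of_def is_quantizer_def Q'_def)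
  then have "mse P T \<phi> Q\<^sub>0 \<le> mse P T \<phi> Q'"
    using opt by (simp add: mse_optimal_def)
  also have "\<dots> \<le> mse P T \<phi> Q"
    unfolding mse_def Q'_def
    by (intro nn_integral_mono)
      (auto intro!: ennreal_leI power_mono near encoder_in_range[OF Q, simplified]
        dest: measurable_space[OF T])
  finally show ?thesis .
qed

text \<open>Pulling the constant out of the integral uses measurability of the squared error. The
  decoder may be an arbitrary function, since its argument lives in a discrete space.\<close>

lemma nn_integral_scaled_squared_error:
  fixes \<phi> :: "'t \<Rightarrow> 'a::euclidean_space"
  assumes Q: "is_quantizer N K Q" and T: "T \<in> P \<rightarrow>\<^sub>M N" and \<phi>: "\<phi> \<in> borel_measurable N"
    and "0 \<le> c"
  shows "(\<integral>\<^sup>+ \<omega>. ennreal (c * (norm (\<phi> (T \<omega>) - decoder Q (encoder Q (T \<omega>))))\<^sup>2) \<partial>P)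
    = ennreal c * mse P T \<phi> Q"
proof -
  have [measurable]: "(\<lambda>\<omega>. \<phi> (T \<omega>)) \<in> borel_measurable P"
    by (rule measurable_compose[OF T \<phi>])
  have "(\<lambda>\<omega>. encoder Q (T \<omega>)) \<in> P \<rightarrow>\<^sub>M count_space {1..K}"
    using measurable_compose[OF T] Q by (simp add: is_quantizer_def)
  from measurable_compose[OF this, of "decoder Q" borel]
  have [measurable]: "(\<lambda>\<omega>. decoder Q (encoder Q (T \<omega>))) \<in> borel_measurable P"
    by simp
  show ?thesis
    unfolding mse_def by (simp add: ennreal_mult' assms(4) nn_integral_cmult)
qed

lemma task_distortion_le_mse:
  fixes \<phi> :: "'t \<Rightarrow> 'a::euclidean_space"
  assumes Q: "is_quantizer N K Q" and T: "T \<in> P \<rightarrow>\<^sub>M N" and \<phi>: "\<phi> \<in> borel_measurable N"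
    and "0 \<le> c" and "\<And>t a. t \<in> space N \<Longrightarrow> l t a \<le> c * (norm (\<phi> t - a))\<^sup>2"
  shows "task_distortion P T l Q \<le> ennreal c * mse P T \<phi> Q"
  unfolding nn_integral_scaled_squared_error[OF assms(1-4), symmetric] task_distortion_def
  by (intro nn_integral_mono ennreal_leI assms(5) measurable_space[OF T])

lemma mse_le_task_distortion:
  fixes \<phi> :: "'t \<Rightarrow> 'a::euclidean_space"
  assumes Q: "is_quantizer N K Q" and T: "T \<in> P \<rightarrow>\<^sub>M N" and \<phi>: "\<phi> \<in> borel_measurable N"
    and "0 \<le> c" and "\<And>t a. t \<in> space N \<Longrightarrow> c * (norm (\<phi> t - a))\<^sup>2 \<le> l t a"
  shows "ennreal c * mse P T \<phi> Q \<le> task_distortion P T l Q"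
  unfolding nn_integral_scaled_squared_error[OF assms(1-4), symmetric] task_distortion_def
  by (intro nn_integral_mono ennreal_leI assms(5) measurable_space[OF T])

text \<open>The chain is D(\<open>Q\<^sub>0\<close>) \<le> \<beta>/2 M(\<open>Q\<^sub>0\<close>)
  \<le> \<beta>/2 M(\<open>Q\<close>) \<le> \<beta>/\<alpha> D(\<open>Q\<close>). An abstract loss
  \<open>l\<close> with two-sided bounds lets both claims of the theorem be instances.\<close>

lemma mse_optimal_task_distortion_le:
  fixes \<phi> :: "'t \<Rightarrow> 'a::euclidean_space"
  assumes opt: "mse_optimal P N T \<phi> K Q\<^sub>0"
    and T: "T \<in> P \<rightarrow>\<^sub>M N" and \<phi>: "\<phi> \<in> borel_measurable N" and K: "1 \<le> K"
    and "0 < \<alpha>" and "0 < \<beta>"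
    and lower: "\<And>t a. t \<in> space N \<Longrightarrow> \<alpha> / 2 * (norm (\<phi> t - a))\<^sup>2 \<le> l t a"
    and upper: "\<And>t a. t \<in> space N \<Longrightarrow> l t a \<le> \<beta> / 2 * (norm (\<phi> t - a))\<^sup>2"
  shows "task_distortion P T l Q\<^sub>0
    \<le> ennreal (\<beta> / \<alpha>) * optimal_task_distortion P N T l K"
proof -
  have Q\<^sub>0: "is_quantizer N K Q\<^sub>0"
    using opt by (simp add: mse_optimal_def is_quantizer_of_def)
  \<comment> \<open>With the factor moved to the left as \<alpha>/\<beta>, the left side is a lower
    bound common to all \<open>Q\<close>, so it passes directly to the infimum.\<close>
  have le: "ennreal (\<alpha> / \<beta>) * task_distortion P T l Q\<^sub>0 \<le> task_distortion P T l Q"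
    if Q: "is_quantizer N K Q" for Q
  proof -
    have "ennreal (\<alpha> / \<beta>) * task_distortion P T l Q\<^sub>0
      \<le> ennreal (\<alpha> / \<beta>) * (ennreal (\<beta> / 2) * mse P T \<phi> Q\<^sub>0)"
      using \<open>0 < \<beta>\<close> by (intro mult_left_mono task_distortion_le_mse[OF Q\<^sub>0 T \<phi> _ upper]) auto
    also have "\<dots> = ennreal (\<alpha> / 2) * mse P T \<phi> Q\<^sub>0"
      using \<open>0 < \<alpha>\<close> \<open>0 < \<beta>\<close> by (simp add: mult.assoc[symmetric] ennreal_mult[symmetric])
    also have "\<dots> \<le> ennreal (\<alpha> / 2) * mse P T \<phi> Q"
      by (intro mult_left_mono mse_optimal_le[OF opt Q T \<phi> K]) simp
    also have "\<dots> \<le> task_distortion P T l Q"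
      using \<open>0 < \<alpha>\<close> by (intro mse_le_task_distortion[OF Q T \<phi> _ lower]) auto
    finally show ?thesis .
  qed
  \<comment> \<open>Cancelling the constants against each other, rather than dividing distortions,
    stays valid when a distortion is infinite.\<close>
  have "ennreal (\<beta> / \<alpha>) * ennreal (\<alpha> / \<beta>) = 1"
    using \<open>0 < \<alpha>\<close> \<open>0 < \<beta>\<close> by (simp add: ennreal_mult[symmetric])
  then have "task_distortion P T l Q\<^sub>0
    = ennreal (\<beta> / \<alpha>) * (ennreal (\<alpha> / \<beta>) * task_distortion P T l Q\<^sub>0)"
    by (metis mult.assoc mult_1)
  also have "\<dots> \<le> ennreal (\<beta> / \<alpha>) * optimal_task_distortion P N T l K"
    unfolding optimal_task_distortion_def using le
    by (intro mult_left_mono INF_greatest) auto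
  finally show ?thesis .
qed

theorem proposition3:
  fixes P :: "'w measure"
    and S :: "(real^'d) set"
    and T :: "'w \<Rightarrow> real^'d"
    and U :: "real^'d \<Rightarrow> real^'r \<Rightarrow> real"
    and \<phi> :: "real^'d \<Rightarrow> real^'r"
    and \<alpha> \<beta> :: real
    and K :: nat
    and Q\<^sub>L\<^sub>M :: "(real^'d, real^'r) quantizer"
  defines "N \<equiv> restrict_space borel S"
  assumes "prob_space P"
    and "T \<in> P \<rightarrow>\<^sub>M N"
    and "0 < \<alpha>" and "\<alpha> \<le> \<beta>"
    and "(\<lambda>(t, a). U t a) \<in> borel_measurable (N \<Otimes>\<^sub>M borel)"
    and "\<phi> \<in> borel_measurable N"
    and "\<And>t. t \<in> S \<Longrightarrow> twice_differentiable (U t)"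
    and A0: "\<And>t a. t \<in> S \<Longrightarrow> U t a \<le> U t (\<phi> t)"
    and A1: "\<And>t a. t \<in> S \<Longrightarrow> loewner_le ((- \<beta>) *\<^sub>R mat 1) (hessian (U t) a)"
    and A2: "\<And>t a. t \<in> S \<Longrightarrow> loewner_le (hessian (U t) a) ((- \<alpha>) *\<^sub>R mat 1)"
    and "1 \<le> K"
    and "mse_optimal P N T \<phi> K Q\<^sub>L\<^sub>M"
  shows "task_distortion P T (task_loss U \<phi>) Q\<^sub>L\<^sub>M
           \<le> ennreal (\<beta> / \<alpha>) * optimal_task_distortion P N T (task_loss U \<phi>) K
    \<and> ((\<exists>u :: real^'d \<Rightarrow> real. \<exists>\<gamma> > 0. \<forall>t \<in> S. \<forall>a. U t a = u t - \<gamma> / 2 * (norm (a - \<phi> t))\<^sup>2)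
        \<longrightarrow> task_distortion P T (task_loss U \<phi>) Q\<^sub>L\<^sub>M
              = optimal_task_distortion P N T (task_loss U \<phi>) K)"
proof -
  have N: "space N = S"
    by (simp add: N_def space_restrict_space)
  note bound = mse_optimal_task_distortion_le[OF assms(13,3,7,12)]
  show ?thesis
  proof (intro conjI impI)
    show "task_distortion P T (task_loss U \<phi>) Q\<^sub>L\<^sub>M
      \<le> ennreal (\<beta> / \<alpha>) * optimal_task_distortion P N T (task_loss U \<phi>) K"
    proof (rule bound)
      show "0 < \<alpha>" "0 < \<beta>"
        using assms(4,5) by auto
      fix t a assume "t \<in> space N"
      then have t: "t \<in> S" by (simp add: N)
      show "\<alpha> / 2 * (norm (\<phi> t - a))\<^sup>2 \<le> task_loss U \<phi> t a"
        unfolding task_loss_def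
        using t by (intro lower_quadratic_bound assms(8) A0 A2)
      show "task_loss U \<phi> t a \<le> \<beta> / 2 * (norm (\<phi> t - a))\<^sup>2"
        unfolding task_loss_def
        using t by (intro upper_quadratic_bound assms(8) A0 A1)
    qed
  next
    assume "\<exists>u :: real^'d \<Rightarrow> real. \<exists>\<gamma> > 0. \<forall>t \<in> S. \<forall>a.
      U t a = u t - \<gamma> / 2 * (norm (a - \<phi> t))\<^sup>2"
    then obtain u :: "real^'d \<Rightarrow> real" and \<gamma> :: real
      where "\<gamma> > 0" and U: "\<And>t a. t \<in> S \<Longrightarrow> U t a = u t - \<gamma> / 2 * (norm (a - \<phi> t))\<^sup>2"
      by blast
    \<comment> \<open>The offset \<open>u t\<close> cancels because
      \<open>U t (\<phi> t) = u t\<close>. The loss meets both quadratic bounds with the single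
      constant \<open>\<gamma>\<close>, so \<open>bound\<close> applies with ratio 1.\<close>
    have "task_loss U \<phi> t a = \<gamma> / 2 * (norm (\<phi> t - a))\<^sup>2" if "t \<in> space N" for t a
      using that by (simp add: N task_loss_def U norm_minus_commute)
    then have "task_distortion P T (task_loss U \<phi>) Q\<^sub>L\<^sub>M
      \<le> ennreal (\<gamma> / \<gamma>) * optimal_task_distortion P N T (task_loss U \<phi>) K"
      using \<open>\<gamma> > 0\<close> by (intro bound) auto
    then have "task_distortion P T (task_loss U \<phi>) Q\<^sub>L\<^sub>M
      \<le> optimal_task_distortion P N T (task_loss U \<phi>) K"
      using \<open>\<gamma> > 0\<close> by simp
    moreover have "optimal_task_distortion P N T (task_loss U \<phi>) K
      \<le> task_distortion P T (task_loss U \<phi>) Q\<^sub>L\<^sub>M"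
      using assms(13) unfolding optimal_task_distortion_def
      by (intro INF_lower) (simp add: mse_optimal_def is_quantizer_of_def)
    ultimately show "task_distortion P T (task_loss U \<phi>) Q\<^sub>L\<^sub>M
      = optimal_task_distortion P N T (task_loss U \<phi>) K"
      by (rule antisym)
  qed
qed

end
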